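(* Let $N, n_x, n_+\ge 1$ be integers, $\alpha>0$, and let $\mathsf{A}^{(k)}\in\mathbb{R}^{n_+\times n_x}$, $b^{(k)}\in\mathbb{R}^{n_+}$ for $k=1,\dots,N$. Let $\sigma^\ast\in\mathbb{R}^{n_x}$ be the minimizer of $$\mathcal{J}(\sigma)=\frac1N\sum_{k=1}^N\left(\frac12\|\mathsf{A}^{(k)}\sigma-b^{(k)}\|_2^2+\frac{\alpha}{2}\|\sigma\|_2^2\right),\qquad \sigma\in\mathbb{R}^{n_x}.$$ Let $(\sigma_n)_{n\ge 0}$ be the stochastic gradient descent iterates with constant learning rate $\eta$ and deterministic initial guess $\sigma_0\in\mathbb{R}^{n_x}$: $$\sigma_{n+1}=\sigma_n-\eta\left(\mathsf{A}^{(\gamma_n)\top}\mathsf{A}^{(\gamma_n)}\sigma_n-\mathsf{A}^{(\gamma_n)\top}b^{(\gamma_n)}+\alpha\sigma_n\right),$$ where $\gamma_0,\gamma_1,\dots$ are independent and uniformly distributed on $\{1,\dots,N\}$. Set $$\mu_{\mathsf{A}}=\frac1N\sum_{k=1}^N\mathsf{A}^{(k)\top}\mathsf{A}^{(k)},\qquad u_n=\mathbb{E}(\sigma_n-\sigma^\ast).$$ Assume that there exists a constant $C_A$ such that $\|\mu_{\mathsf{A}}\|_2\le C_A$. If $0<\eta<\frac{2}{C_A+\alpha}$, then, with $\lambda:=\|\mathbb{I}-\eta\mu_{\mathsf{A}}-\eta\alpha\mathbb{I}\|_2$, one has $|\lambda|<1$ and $$\|u_n\|_2\le\lambda^n\|u_0\|_2\qquad\text{for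 all } n\ge 0.$$
   Context: $\|\cdot\|_2$ denotes the Euclidean norm of vectors and the induced operator (spectral) norm of matrices; $\mathbb{I}$ is the $n_x\times n_x$ identity matrix; expectations are over the random indices $\gamma_n$. Origin of the data: the problem is the discretization of the linearized inverse problem for the radiative transfer equation, with $n_x$ grid points $x_n$ in the spatial domain and $n_+$ grid points $(x_{\ast,m},v_{\ast,m})$ on the outgoing boundary. $\mathsf{A}^{(k)}_{mn}=\beta^{(k)}(x_n,x_{\ast,m},v_{\ast,m})\Delta x_n$ discretizes the integral operator $\sigma\mapsto\int\beta^{(k)}\sigma\,dx$ whose kernel $\beta^{(k)}$ comes from the $k$-th experiment, $\Delta x_n$ is the volume represented by grid point $x_n$, $b^{(k)}$ is the vector of outgoing data of the $k$-th experiment minus the background prediction, and $\alpha$ is the regularization parameter. For the statement these are treated as given real matrices and vectors. *)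

theory Defs
  imports "HOL-Probability.Probability"
begin

text \<open>
  The dimensions \<open>n\<^sub>x\<close> and \<open>n\<^sub>+\<close> are the cardinalities of the finite index types \<open>'nx\<close> and \<open>'np\<close>.
  The experiments are indexed by \<open>{1..N}\<close>; values of \<open>A\<close> and \<open>b\<close> outside this set are irrelevant.
\<close>

definition objective ::
    "nat \<Rightarrow> (nat \<Rightarrow> real ^ 'nx ^ 'np) \<Rightarrow> (nat \<Rightarrow> real ^ 'np) \<Rightarrow> real \<Rightarrow> real ^ 'nx \<Rightarrow> real" where
  "objective N A b \<alpha> \<sigma> =
     1 / real N * (\<Sum>k = 1..N. (1 / 2 * (norm (A k *v \<sigma> - b k))\<^sup>2 + \<alpha> / 2 * (norm \<sigma>)\<^sup>2))"

definition mean_gram :: "nat \<Rightarrow> (nat \<Rightarrow> real ^ 'nx ^ 'np) \<Rightarrow> real ^ 'nx ^ 'nx" where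
  "mean_gram N A = (1 / real N) *\<^sub>R (\<Sum>k = 1..N. transpose (A k) ** A k)"

text \<open>
  The norm that the library puts on the matrix type itself is the Frobenius norm,
  hence the induced norm has to be taken of the associated linear map.
\<close>

definition spectral_norm :: "real ^ 'n ^ 'm \<Rightarrow> real" where
  "spectral_norm B = onorm (\<lambda>x. B *v x)"

primrec sgd ::
    "(nat \<Rightarrow> real ^ 'nx ^ 'np) \<Rightarrow> (nat \<Rightarrow> real ^ 'np) \<Rightarrow> real \<Rightarrow> real \<Rightarrow> real ^ 'nx
      \<Rightarrow> (nat \<Rightarrow> 'w \<Rightarrow> nat) \<Rightarrow> nat \<Rightarrow> 'w \<Rightarrow> real ^ 'nx" where
  "sgd A b \<alpha> \<eta> \<sigma>0 \<gamma> 0 = (\<lambda>\<omega>. \<sigma>0)"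
| "sgd A b \<alpha> \<eta> \<sigma>0 \<gamma> (Suc n) = (\<lambda>\<omega>.
     let \<sigma> = sgd A b \<alpha> \<eta> \<sigma>0 \<gamma> n \<omega>; k = \<gamma> n \<omega> in
       \<sigma> - \<eta> *\<^sub>R (transpose (A k) *v (A k *v \<sigma>) - transpose (A k) *v b k + \<alpha> *\<^sub>R \<sigma>))"

definition iid_uniform_indices :: "'w measure \<Rightarrow> nat \<Rightarrow> (nat \<Rightarrow> 'w \<Rightarrow> nat) \<Rightarrow> bool" where
  "iid_uniform_indices M N \<gamma> \<longleftrightarrow>
     prob_space.indep_vars M (\<lambda>n. count_space {1..N}) \<gamma> UNIV \<and>
     (\<forall>n. distr M (count_space {1..N}) (\<gamma> n) = uniform_count_measure {1..N})"

end

theory Submission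
  imports Defs
begin

text \<open>
  Since \<open>\<gamma> n\<close> is independent of the \<open>n\<close>-th iterate, averaging one step replaces the random
  Gram matrix by its mean \<open>\<mu>\<close>; subtracting the normal equation
  \<open>\<mu> \<sigma>\<^sup>* + \<alpha> \<sigma>\<^sup>* = N\<^sup>-\<^sup>1 \<Sum>\<^sub>k A\<^sub>k\<^sup>T b\<^sub>k\<close> satisfied by the minimizer turns the mean recursion into
  \<open>u\<^sub>n\<^sub>+\<^sub>1 = (I - \<eta>\<mu> - \<eta>\<alpha>I) u\<^sub>n\<close>.
  The rate is below 1 without diagonalizing \<open>\<mu>\<close>: a positive semidefinite \<open>\<mu>\<close> with norm at
  most \<open>C\<close> satisfies \<open>|\<mu>x|\<^sup>2 \<le> C \<langle>x, \<mu>x\<rangle>\<close>, which bounds \<open>|(I - \<eta>\<mu> - \<eta>\<alpha>I) x|\<^sup>2\<close> by an affine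
  function of \<open>\<langle>x, \<mu>x\<rangle> \<in> [0, C|x|\<^sup>2]\<close>, whose values at the two endpoints are
  \<open>(1 - \<eta>\<alpha>)\<^sup>2 |x|\<^sup>2\<close> and \<open>(1 - \<eta>\<alpha> - \<eta>C)\<^sup>2 |x|\<^sup>2\<close>.
\<close>

section \<open>Contraction factor of a regularized gradient step\<close>

text \<open>Positivity of the quadratic form of \<open>T\<close> is used at the shifted point
  \<open>x - (1 / C) *\<^sub>R T x\<close>; the term of highest order in the expansion is controlled
  by Cauchy-Schwarz and \<open>bound\<close>. If \<open>C\<close> is not positive,
  \<open>bound\<close> forces \<open>T x = 0\<close>.\<close>

lemma selfadjoint_psd_cocoercive:
  fixes T :: "'a::real_inner \<Rightarrow> 'a"
  assumes "linear T"
    and sym: "\<And>x y. T x \<bullet> y = x \<bullet> T y"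
    and psd: "\<And>x. 0 \<le> x \<bullet> T x"
    and bound: "\<And>x. norm (T x) \<le> C * norm x"
  shows "(norm (T x))\<^sup>2 \<le> C * (x \<bullet> T x)"
proof (cases "C > 0")
  case False
  then have "C * norm x \<le> 0"
    by (simp add: mult_nonpos_nonneg)
  then have "T x = 0"
    using bound[of x] by (metis norm_le_zero_iff order_trans)
  then show ?thesis by simp
next
  case True
  interpret linear T by fact
  define q where "q = (norm (T x))\<^sup>2"
  have "T x \<bullet> T (T x) \<le> norm (T x) * norm (T (T x))"
    by (rule norm_cauchy_schwarz)
  also have "\<dots> \<le> norm (T x) * (C * norm (T x))"
    by (rule mult_left_mono[OF bound]) simp
  finally have "T x \<bullet> T (T x) \<le> C * q"
    by (simp add: q_def power2_eq_square ac_simps)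
  then have *: "(1 / C)\<^sup>2 * (T x \<bullet> T (T x)) \<le> (1 / C)\<^sup>2 * (C * q)"
    by (rule mult_left_mono) simp
  \<comment> \<open>For a shift by \<open>s *\<^sub>R T x\<close> the upper bound becomes
    \<open>x \<bullet> T x - 2 * s * q + s\<^sup>2 * C * q\<close>, which is smallest at
    \<open>s = 1 / C\<close>.\<close>
  have "0 \<le> (x - (1 / C) *\<^sub>R T x) \<bullet> T (x - (1 / C) *\<^sub>R T x)"
    by (rule psd)
  also have "\<dots> = x \<bullet> T x - 2 * (1 / C) * q + (1 / C)\<^sup>2 * (T x \<bullet> T (T x))"
    unfolding q_def power2_norm_eq_inner using sym[of x "T x"]
    by (simp add: diff scale inner_diff_left inner_diff_right power2_eq_square inner_commute
        algebra_simps)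
  also have "\<dots> \<le> x \<bullet> T x - q / C"
    using * True by (simp add: power2_eq_square field_simps)
  finally show ?thesis
    using True by (simp add: q_def field_simps)
qed

text \<open>The factor \<open>r\<close> does not depend on \<open>x\<close>, so it also bounds the
  operator norm; a strict decrease at each single \<open>x\<close> would not give this
  directly.\<close>

lemma regularized_gradient_step_contraction:
  fixes T :: "'a::real_inner \<Rightarrow> 'a"
  assumes lin: "linear T"
    and sym: "\<And>x y. T x \<bullet> y = x \<bullet> T y"
    and psd: "\<And>x. 0 \<le> x \<bullet> T x"
    and bound: "\<And>x. norm (T x) \<le> C * norm x"
    and "0 \<le> C" "0 < \<alpha>" "0 < \<eta>" "\<eta> < 2 / (C + \<alpha>)"
  obtains r where "0 \<le> r" "r < 1"
    "\<And>x. norm (x - \<eta> *\<^sub>R T x - (\<eta> * \<alpha>) *\<^sub>R x) \<le> r * norm x"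
proof
  \<comment> \<open>This is the maximum of the modulus of
    \<open>1 - \<eta> * \<alpha> - \<eta> * t\<close> over \<open>t\<close> in
    \<open>[0, C]\<close>, attained at an endpoint. The upper bound on \<open>\<eta>\<close> keeps
    both values above -1.\<close>
  define r where "r = max \<bar>1 - \<eta> * \<alpha>\<bar> \<bar>1 - \<eta> * \<alpha> - \<eta> * C\<bar>"
  have "\<eta> * \<alpha> + \<eta> * C < 2"
    using assms(5-8) by (simp add: field_simps)
  moreover have "0 < \<eta> * \<alpha>" "0 \<le> \<eta> * C"
    using assms(5-8) by simp_all
  ultimately show "r < 1"
    by (auto simp: r_def abs_if)
  show "0 \<le> r"
    by (simp add: r_def)
  fix x
  define p n where "p = x \<bullet> T x" and "n = (norm x)\<^sup>2"
  have "p \<le> norm x * norm (T x)"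
    unfolding p_def by (rule norm_cauchy_schwarz)
  also have "\<dots> \<le> norm x * (C * norm x)"
    by (rule mult_left_mono[OF bound]) simp
  finally have p: "0 \<le> p" "p \<le> C * n"
    using psd by (simp_all add: p_def n_def power2_eq_square ac_simps)
  have T: "(norm (T x))\<^sup>2 \<le> C * p"
    unfolding p_def by (rule selfadjoint_psd_cocoercive[OF lin sym psd bound])
  have r1: "(1 - \<eta> * \<alpha>)\<^sup>2 \<le> r\<^sup>2"
    by (rule abs_le_square_iff[THEN iffD1]) (simp add: r_def)
  have r2: "(1 - \<eta> * \<alpha> - \<eta> * C)\<^sup>2 \<le> r\<^sup>2"
    by (rule abs_le_square_iff[THEN iffD1]) (simp add: r_def)
  have "(norm (x - \<eta> *\<^sub>R T x - (\<eta> * \<alpha>) *\<^sub>R x))\<^sup>2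
      = (1 - \<eta> * \<alpha>)\<^sup>2 * n - 2 * (1 - \<eta> * \<alpha>) * \<eta> * p + \<eta>\<^sup>2 * (norm (T x))\<^sup>2"
    unfolding power2_norm_eq_inner p_def n_def
    by (simp add: inner_diff_left inner_diff_right inner_commute power2_eq_square algebra_simps)
  also have "\<dots> \<le> (1 - \<eta> * \<alpha>)\<^sup>2 * n - 2 * (1 - \<eta> * \<alpha>) * \<eta> * p + \<eta>\<^sup>2 * (C * p)"
    using mult_left_mono[OF T, of "\<eta>\<^sup>2"] by simp
  also have "\<dots> \<le> r\<^sup>2 * n"
  proof (cases "C = 0")
    case True
    then have "p = 0"
      using p by simp
    then show ?thesis
      using mult_right_mono[OF r1, of n] by (simp add: n_def)
  next
    case False
    then have "0 < C"
      using \<open>0 \<le> C\<close> by simp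
    \<comment> \<open>Linear interpolation in \<open>p\<close> between the endpoints
      \<open>0\<close> and \<open>C * n\<close>; both weights \<open>C * n - p\<close> and
      \<open>p\<close> are nonnegative. The factor \<open>C\<close> clears the denominator, hence
      the separate case \<open>C = 0\<close>.\<close>
    have "C * ((1 - \<eta> * \<alpha>)\<^sup>2 * n - 2 * (1 - \<eta> * \<alpha>) * \<eta> * p + \<eta>\<^sup>2 * (C * p))
        = (1 - \<eta> * \<alpha>)\<^sup>2 * (C * n - p) + (1 - \<eta> * \<alpha> - \<eta> * C)\<^sup>2 * p"
      by (simp add: power2_eq_square algebra_simps)
    also have "\<dots> \<le> r\<^sup>2 * (C * n - p) + r\<^sup>2 * p"
      using p by (intro add_mono mult_right_mono r1 r2) simp_all
    also have "\<dots> = C * (r\<^sup>2 * n)"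
      by (simp add: algebra_simps)
    finally show ?thesis
      using \<open>0 < C\<close> by simp
  qed
  also have "\<dots> = (r * norm x)\<^sup>2"
    by (simp add: n_def power_mult_distrib)
  finally show "norm (x - \<eta> *\<^sub>R T x - (\<eta> * \<alpha>) *\<^sub>R x) \<le> r * norm x"
    by (rule power2_le_imp_le) (simp add: \<open>0 \<le> r\<close>)
qed

section \<open>Spectral norm and the mean Gram matrix\<close>

lemma spectral_norm_mult: "norm (B *v x) \<le> spectral_norm B * norm x"
  unfolding spectral_norm_def
  by (rule onorm[OF matrix_vector_mul_bounded_linear])

lemma spectral_norm_nonneg: "0 \<le> spectral_norm B"
  unfolding spectral_norm_def
  by (rule onorm_pos_le[OF matrix_vector_mul_bounded_linear])

lemma sum_matrix_vector_mult: "(\<Sum>k\<in>K. B k) *v x = (\<Sum>k\<in>K. B k *v x)"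
  for B :: "'k \<Rightarrow> real ^ 'n ^ 'm"
  by (induction K rule: infinite_finite_induct) (simp_all add: matrix_vector_mult_add_rdistrib)

lemma mean_gram_mult:
  "mean_gram N A *v x = (1 / real N) *\<^sub>R (\<Sum>k = 1..N. transpose (A k) *v (A k *v x))"
  by (simp add: mean_gram_def sum_matrix_vector_mult scaleR_matrix_vector_assoc[symmetric]
      matrix_vector_mul_assoc del: transpose_matrix_vector)

lemma inner_transpose_mult: "x \<bullet> (transpose B *v y) = (B *v x) \<bullet> y"
  for B :: "real ^ 'n ^ 'm"
  by (metis dot_lmul_matrix inner_commute transpose_matrix_vector)

text \<open>Symmetry of the mean Gram matrix can be read off this form, and so can positivity, since
  \<open>x = y\<close> gives an average of squared norms.\<close>

lemma inner_mean_gram: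
  "x \<bullet> (mean_gram N A *v y) = (1 / real N) * (\<Sum>k = 1..N. (A k *v x) \<bullet> (A k *v y))"
  by (simp add: mean_gram_mult inner_sum_right inner_transpose_mult del: transpose_matrix_vector)

section \<open>First-order condition at the minimizer\<close>

text \<open>The objective is quadratic, so its second-order Taylor expansion is exact. The
  coefficient of \<open>t\<close> is the derivative in direction \<open>d\<close>, which makes the
  gradient available without differentiating.\<close>

lemma objective_along_line:
  fixes A :: "nat \<Rightarrow> real ^ 'nx ^ 'np"
  assumes "N \<ge> 1"
  shows "objective N A b \<alpha> (\<sigma> + t *\<^sub>R d) = objective N A b \<alpha> \<sigma>
    + t * (d \<bullet> (mean_gram N A *v \<sigma> - (1 / real N) *\<^sub>R (\<Sum>k = 1..N. transpose (A k) *v b k) + \<alpha> *\<^sub>R \<sigma>))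
    + t\<^sup>2 * (1 / 2 * (d \<bullet> (mean_gram N A *v d)) + \<alpha> / 2 * (norm d)\<^sup>2)"
proof -
  let ?f = "\<lambda>k. 1 / 2 * (norm (A k *v \<sigma> - b k))\<^sup>2 + \<alpha> / 2 * (norm \<sigma>)\<^sup>2"
  let ?g = "\<lambda>k. (A k *v d) \<bullet> (A k *v \<sigma>) - (A k *v d) \<bullet> b k + \<alpha> * (d \<bullet> \<sigma>)"
  let ?h = "\<lambda>k. 1 / 2 * ((A k *v d) \<bullet> (A k *v d)) + \<alpha> / 2 * (norm d)\<^sup>2"
  have "1 / 2 * (norm (A k *v (\<sigma> + t *\<^sub>R d) - b k))\<^sup>2 + \<alpha> / 2 * (norm (\<sigma> + t *\<^sub>R d))\<^sup>2
      = ?f k + t * ?g k + t\<^sup>2 * ?h k" for k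
    unfolding power2_norm_eq_inner
    by (simp add: matrix_vector_right_distrib matrix_vector_mult_scaleR inner_add_left
        inner_add_right inner_diff_left inner_diff_right inner_commute power2_eq_square field_simps)
  then have "objective N A b \<alpha> (\<sigma> + t *\<^sub>R d)
      = 1 / real N * (\<Sum>k = 1..N. ?f k + t * ?g k + t\<^sup>2 * ?h k)"
    by (simp only: objective_def)
  also have "\<dots> = objective N A b \<alpha> \<sigma> + t * (1 / real N * sum ?g {1..N})
      + t\<^sup>2 * (1 / real N * sum ?h {1..N})"
    unfolding objective_def by (simp only: sum.distrib sum_distrib_left[symmetric]) algebra
  also have "1 / real N * sum ?g {1..N}
      = d \<bullet> (mean_gram N A *v \<sigma> - (1 / real N) *\<^sub>R (\<Sum>k = 1..N. transpose (A k) *v b k) + \<alpha> *\<^sub>R \<sigma>)"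
    \<comment> \<open>\<open>N \<ge> 1\<close> ensures that averaging the regularization term, which
      is the same for all \<open>k\<close>, returns that term.\<close>
    using assms
    by (simp add: inner_mean_gram inner_sum_right inner_transpose_mult inner_add_right
        inner_diff_right sum.distrib sum_subtractf field_simps del: transpose_matrix_vector)
  also have "1 / real N * sum ?h {1..N} = 1 / 2 * (d \<bullet> (mean_gram N A *v d)) + \<alpha> / 2 * (norm d)\<^sup>2"
    using assms by (simp add: inner_mean_gram sum.distrib sum_divide_distrib[symmetric] field_simps)
  finally show ?thesis .
qed

text \<open>For small \<open>t\<close> of sign opposite to \<open>a\<close> the linear term would
  dominate and make the expression negative.\<close>

lemma linear_coeff_zero_if_quadratic_nonneg:
  fixes a q :: real
  assumes "\<And>t. 0 \<le> t * a + t\<^sup>2 * q"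
  shows "a = 0"
proof (rule ccontr)
  assume "a \<noteq> 0"
  \<comment> \<open>At \<open>t = - a / s\<close> the expression equals
    \<open>a\<^sup>2 * (q - s) / s\<^sup>2\<close>, so \<open>s\<close> only has to be positive and
    larger than \<open>q\<close>.\<close>
  define s where "s = \<bar>q\<bar> + 1"
  have "s > 0" "q < s"
    by (auto simp: s_def)
  have "0 \<le> s\<^sup>2 * ((- a / s) * a + (- a / s)\<^sup>2 * q)"
    using assms[of "- a / s"] by simp
  also have "\<dots> = a\<^sup>2 * (q - s)"
    using \<open>s > 0\<close> by (simp add: field_simps power2_eq_square)
  also have "\<dots> < 0"
    using \<open>a \<noteq> 0\<close> \<open>q < s\<close> by (simp add: mult_pos_neg)
  finally show False by simp
qed

text \<open>Taking the gradient itself as the direction makes the linear coefficient its squared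
  norm, which must vanish. The averaged data stand alone on the left so that they can be substituted
  in the mean recursion.\<close>

lemma normal_equation:
  fixes A :: "nat \<Rightarrow> real ^ 'nx ^ 'np"
  assumes "N \<ge> 1" and min: "is_arg_min (objective N A b \<alpha>) (\<lambda>\<sigma>. True) \<sigma>"
  shows "(1 / real N) *\<^sub>R (\<Sum>k = 1..N. transpose (A k) *v b k) = mean_gram N A *v \<sigma> + \<alpha> *\<^sub>R \<sigma>"
proof -
  let ?g = "mean_gram N A *v \<sigma> - (1 / real N) *\<^sub>R (\<Sum>k = 1..N. transpose (A k) *v b k) + \<alpha> *\<^sub>R \<sigma>"
  have "?g \<bullet> ?g = 0"
  proof (rule linear_coeff_zero_if_quadratic_nonneg)
    fix t
    have "objective N A b \<alpha> \<sigma> \<le> objective N A b \<alpha> (\<sigma> + t *\<^sub>R ?g)"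
      using min by (simp add: is_arg_min_linorder)
    then show "0 \<le> t * (?g \<bullet> ?g)
        + t\<^sup>2 * (1 / 2 * (?g \<bullet> (mean_gram N A *v ?g)) + \<alpha> / 2 * (norm ?g)\<^sup>2)"
      unfolding objective_along_line[OF \<open>N \<ge> 1\<close>] by linarith
  qed
  then have "?g = 0"
    by (simp only: inner_eq_zero_iff)
  then show ?thesis
    by (simp add: algebra_simps del: transpose_matrix_vector)
qed

section \<open>Expectations over an independent finite index\<close>

text \<open>
  Library independence requires both variables to have the same type, hence the
  detour through \<open>g\<close> to a finite index type.
\<close>

lemma (in prob_space) expectation_indep_finite:
  fixes F :: "'k \<Rightarrow> 'h \<Rightarrow> 'c::euclidean_space"
  assumes indep: "indep_var S X T Y" and "finite K"
    and g: "g \<in> measurable T (count_space K)"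
    and F: "\<And>k. k \<in> K \<Longrightarrow> F k \<in> borel_measurable S"
    and int: "\<And>k. k \<in> K \<Longrightarrow> integrable M (\<lambda>\<omega>. F k (X \<omega>))"
  shows "expectation (\<lambda>\<omega>. F (g (Y \<omega>)) (X \<omega>))
    = (\<Sum>k\<in>K. prob ((\<lambda>\<omega>. g (Y \<omega>)) -` {k} \<inter> space M) *\<^sub>R expectation (\<lambda>\<omega>. F k (X \<omega>)))"
proof -
  have X: "X \<in> measurable M S" and Y: "Y \<in> measurable M T"
    using indep_var_rv1[OF indep] indep_var_rv2[OF indep] by auto
  have gY: "(\<lambda>\<omega>. g (Y \<omega>)) \<in> measurable M (count_space K)"
    using Y g by (rule measurable_compose)
  then have K: "g (Y \<omega>) \<in> K" if "\<omega> \<in> space M" for \<omega>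
    using that by (auto dest: measurable_space)
  let ?E = "\<lambda>k. (\<lambda>\<omega>. g (Y \<omega>)) -` {k} \<inter> space M"
  let ?I = "\<lambda>k \<omega>. indicator {k} (g (Y \<omega>)) :: real"
  have I: "integrable M (?I k)" "expectation (?I k) = prob (?E k)" if "k \<in> K" for k
  proof -
    have "?E k \<in> sets M"
      using gY that by (intro measurable_sets[of _ M "count_space K"]) auto
    moreover have "?I k \<omega> = indicator (?E k) \<omega>" if "\<omega> \<in> space M" for \<omega>
      using that by (simp add: indicator_def)
    ultimately show "integrable M (?I k)" "expectation (?I k) = prob (?E k)"
      by (simp_all cong: Bochner_Integration.integrable_cong Bochner_Integration.integral_cong
          add: emeasure_eq_measure)
  qed
  \<comment> \<open>For a fixed value \<open>k\<close> the indicator depends on \<open>Y\<close>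
    alone and \<open>F k (X \<omega>)\<close> on \<open>X\<close> alone, so the expectation of their
    product factorizes.\<close>
  have J: "integrable M (\<lambda>\<omega>. ?I k \<omega> *\<^sub>R F k (X \<omega>))"
    "expectation (\<lambda>\<omega>. ?I k \<omega> *\<^sub>R F k (X \<omega>)) = prob (?E k) *\<^sub>R expectation (\<lambda>\<omega>. F k (X \<omega>))"
    if k: "k \<in> K" for k
  proof -
    show int': "integrable M (\<lambda>\<omega>. ?I k \<omega> *\<^sub>R F k (X \<omega>))"
    proof (rule Bochner_Integration.integrable_bound[OF int[OF k]])
      show "(\<lambda>\<omega>. ?I k \<omega> *\<^sub>R F k (X \<omega>)) \<in> borel_measurable M"
        using I[OF k] int[OF k] by (intro borel_measurable_scaleR) auto
    qed (simp add: indicator_def)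
    show "expectation (\<lambda>\<omega>. ?I k \<omega> *\<^sub>R F k (X \<omega>)) = prob (?E k) *\<^sub>R expectation (\<lambda>\<omega>. F k (X \<omega>))"
    \<comment> \<open>The product rule for expectations concerns scalar variables, so it is applied
      to each coordinate.\<close>
    proof (rule euclidean_eqI)
      fix e :: 'c
      have "(\<lambda>x. F k x \<bullet> e) \<in> borel_measurable S"
        using F[OF k] by (intro borel_measurable_inner) auto
      moreover have "(\<lambda>y. indicator {k} (g y) :: real) \<in> borel_measurable T"
        using g by (rule measurable_compose) simp
      ultimately have "indep_var borel ((\<lambda>x. F k x \<bullet> e) \<circ> X) borel ((\<lambda>y. indicator {k} (g y) :: real) \<circ> Y)"
        by (rule indep_var_compose[OF indep])
      then have "indep_var borel (\<lambda>\<omega>. F k (X \<omega>) \<bullet> e) borel (?I k)"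
        by (simp add: comp_def)
      then have "expectation (\<lambda>\<omega>. (F k (X \<omega>) \<bullet> e) * ?I k \<omega>)
          = expectation (\<lambda>\<omega>. F k (X \<omega>) \<bullet> e) * expectation (?I k)"
        by (rule indep_var_lebesgue_integral) (use I int k in auto)
      then show "expectation (\<lambda>\<omega>. ?I k \<omega> *\<^sub>R F k (X \<omega>)) \<bullet> e
          = (prob (?E k) *\<^sub>R expectation (\<lambda>\<omega>. F k (X \<omega>))) \<bullet> e"
        using int' int[OF k] I(2)[OF k]
        by (simp add: integral_inner_left[symmetric] mult.commute del: integral_inner_left)
    qed
  qed
  \<comment> \<open>At each \<open>\<omega>\<close> exactly one indicator is nonzero, the one for
    the value that \<open>g (Y \<omega>)\<close> takes.\<close>
  have "expectation (\<lambda>\<omega>. F (g (Y \<omega>)) (X \<omega>)) = expectation (\<lambda>\<omega>. \<Sum>k\<in>K. ?I k \<omega> *\<^sub>R F k (X \<omega>))"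
  proof (rule Bochner_Integration.integral_cong)
    fix \<omega> assume "\<omega> \<in> space M"
    then have "(\<Sum>k\<in>K. ?I k \<omega> *\<^sub>R F k (X \<omega>)) = (\<Sum>k\<in>{g (Y \<omega>)}. ?I k \<omega> *\<^sub>R F k (X \<omega>))"
      using \<open>finite K\<close> K by (intro sum.mono_neutral_right) auto
    then show "F (g (Y \<omega>)) (X \<omega>) = (\<Sum>k\<in>K. ?I k \<omega> *\<^sub>R F k (X \<omega>))"
      by simp
  qed simp
  also have "\<dots> = (\<Sum>k\<in>K. expectation (\<lambda>\<omega>. ?I k \<omega> *\<^sub>R F k (X \<omega>)))"
    by (rule Bochner_Integration.integral_sum) (rule J)
  finally show ?thesis
    by (simp add: J)
qed

section \<open>Iterates as functions of the index history\<close>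

lemma sgd_cong:
  assumes "\<And>i. i < n \<Longrightarrow> \<gamma> i \<omega> = \<gamma>' i \<omega>'"
  shows "sgd A b \<alpha> \<eta> \<sigma>0 \<gamma> n \<omega> = sgd A b \<alpha> \<eta> \<sigma>0 \<gamma>' n \<omega>'"
  using assms by (induction n) (simp_all add: Let_def)

text \<open>Running \<open>sgd\<close> on the coordinate maps \<open>\<lambda>i h. h i\<close> gives
  a deterministic function of the history. Index \<open>n\<close> is excluded from the history of
  iterate \<open>n\<close>, which is what later yields their independence.\<close>

lemma sgd_eq_sgd_restrict:
  "sgd A b \<alpha> \<eta> \<sigma>0 \<gamma> n \<omega> = sgd A b \<alpha> \<eta> \<sigma>0 (\<lambda>i h. h i) n (restrict (\<lambda>i. \<gamma> i \<omega>) {..<n})"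
  by (rule sgd_cong) simp

text \<open>A finite product of finite discrete spaces is again discrete, so measurability of any
  function of the history reduces to its range.\<close>

lemma measurable_PiM_count_space_finite:
  assumes "finite I" "finite K"
  shows "measurable (PiM I (\<lambda>i. count_space K)) T = PiE I (\<lambda>i. K) \<rightarrow> space T"
  using assms by (subst count_space_PiM_finite) (auto intro: countable_finite)

text \<open>Only finitely many histories of length \<open>n\<close> exist, so the iterate takes
  finitely many values and is bounded.\<close>

lemma (in prob_space) integrable_sgd:
  assumes indep: "indep_vars (\<lambda>n. count_space {1..N}) \<gamma> UNIV"
  shows "integrable M (sgd A b \<alpha> \<eta> \<sigma>0 \<gamma> n)"
proof -
  let ?S = "sgd A b \<alpha> \<eta> \<sigma>0 (\<lambda>i h. h i) n"
  let ?H = "PiE {..<n} (\<lambda>i. {1..N})"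
  have meas: "\<gamma> i \<in> measurable M (count_space {1..N})" for i
    using indep by (auto simp: indep_vars_def)
  have \<gamma>: "\<gamma> i \<omega> \<in> {1..N}" if "\<omega> \<in> space M" for i \<omega>
    using measurable_space[OF meas that] by simp
  have "finite (?S ` ?H)"
    by (intro finite_imageI finite_PiE) auto
  then obtain B where B: "\<And>h. h \<in> ?H \<Longrightarrow> norm (?S h) \<le> B"
    using finite_imp_bounded bounded_iff by (metis imageI)
  have "norm (sgd A b \<alpha> \<eta> \<sigma>0 \<gamma> n \<omega>) \<le> B" if "\<omega> \<in> space M" for \<omega>
    unfolding sgd_eq_sgd_restrict[of A b \<alpha> \<eta> \<sigma>0 \<gamma>] by (rule B) (use \<gamma>[OF that] in auto)
  moreover have "sgd A b \<alpha> \<eta> \<sigma>0 \<gamma> n \<in> borel_measurable M"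
  proof -
    from meas have "(\<lambda>\<omega>. restrict (\<lambda>i. \<gamma> i \<omega>) {..<n})
        \<in> measurable M (PiM {..<n} (\<lambda>i. count_space {1..N}))"
      by (intro measurable_restrict)
    moreover have "?S \<in> borel_measurable (PiM {..<n} (\<lambda>i. count_space {1..N}))"
      by (simp add: measurable_PiM_count_space_finite)
    ultimately show ?thesis
      unfolding sgd_eq_sgd_restrict[of A b \<alpha> \<eta> \<sigma>0 \<gamma>] by (rule measurable_compose)
  qed
  ultimately show ?thesis
    by (intro integrable_const_bound[of _ B]) auto
qed

text \<open>For a fixed index the update is affine and commutes with the expectation; the
  independent index then averages these updates with weights \<open>1 / real N\<close>.\<close>

lemma (in prob_space) expectation_sgd_Suc:
  fixes A :: "nat \<Rightarrow> real ^ 'nx ^ 'np" and b :: "nat \<Rightarrow> real ^ 'np"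
    and \<alpha> \<eta> :: real and \<sigma>0 :: "real ^ 'nx"
  assumes "N \<ge> 1" and iid: "iid_uniform_indices M N \<gamma>"
  defines "m \<equiv> \<lambda>n. expectation (sgd A b \<alpha> \<eta> \<sigma>0 \<gamma> n)"
  shows "m (Suc n) = m n - \<eta> *\<^sub>R (mean_gram N A *v m n
    - (1 / real N) *\<^sub>R (\<Sum>k = 1..N. transpose (A k) *v b k) + \<alpha> *\<^sub>R m n)"
proof -
  have indep: "indep_vars (\<lambda>n. count_space {1..N}) \<gamma> UNIV"
    and unif: "distr M (count_space {1..N}) (\<gamma> n) = uniform_count_measure {1..N}"
    using iid by (auto simp: iid_uniform_indices_def)
  have \<gamma>: "\<gamma> n \<in> measurable M (count_space {1..N})"
    using indep by (auto simp: indep_vars_def)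
  have prob: "prob (\<gamma> n -` {k} \<inter> space M) = 1 / real N" if "k \<in> {1..N}" for k
  proof -
    have "prob (\<gamma> n -` {k} \<inter> space M) = measure (distr M (count_space {1..N}) (\<gamma> n)) {k}"
      using that by (intro measure_distr[OF \<gamma>, symmetric]) simp
    also have "\<dots> = 1 / real N"
      unfolding unif using that by (subst measure_uniform_count_measure) auto
    finally show ?thesis .
  qed
  let ?X = "sgd A b \<alpha> \<eta> \<sigma>0 \<gamma> n"
  let ?F = "\<lambda>k x. x - \<eta> *\<^sub>R (transpose (A k) *v (A k *v x) - transpose (A k) *v b k + \<alpha> *\<^sub>R x)"
  have X: "integrable M ?X"
    by (rule integrable_sgd[OF indep])
  have bl: "bounded_linear (\<lambda>x. transpose (A k) *v (A k *v x))" for k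
    by (simp add: matrix_vector_mul_assoc matrix_vector_mul_bounded_linear)
  have G: "integrable M (\<lambda>\<omega>. transpose (A k) *v (A k *v ?X \<omega>))"
    "expectation (\<lambda>\<omega>. transpose (A k) *v (A k *v ?X \<omega>)) = transpose (A k) *v (A k *v m n)" for k
    using integrable_bounded_linear[OF bl X] integral_bounded_linear[OF bl X] by (simp_all add: m_def)
  have F: "integrable M (\<lambda>\<omega>. ?F k (?X \<omega>))" "expectation (\<lambda>\<omega>. ?F k (?X \<omega>)) = ?F k (m n)" for k
    using X G[of k] by (simp_all add: m_def prob_space)
  let ?H = "\<lambda>I \<omega>. restrict (\<lambda>i. \<gamma> i \<omega>) I"
  let ?S = "sgd A b \<alpha> \<eta> \<sigma>0 (\<lambda>i h. h i) n"
  have S: "?S (?H {..<n} \<omega>) = ?X \<omega>" for \<omega>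
    by (rule sgd_eq_sgd_restrict[symmetric])
  \<comment> \<open>The two index blocks are disjoint. The current index is encoded as a history
    over \<open>{n}\<close>, and \<open>g = (\<lambda>h. h n)\<close> reads it back.\<close>
  have "indep_var (PiM {..<n} (\<lambda>i. count_space {1..N})) (?H {..<n})
      (PiM {n} (\<lambda>i. count_space {1..N})) (?H {n})"
    by (rule indep_var_restrict[OF indep]) auto
  then have "expectation (\<lambda>\<omega>. ?F (?H {n} \<omega> n) (?S (?H {..<n} \<omega>)))
      = (\<Sum>k = 1..N. prob ((\<lambda>\<omega>. ?H {n} \<omega> n) -` {k} \<inter> space M)
          *\<^sub>R expectation (\<lambda>\<omega>. ?F k (?S (?H {..<n} \<omega>))))"
    by (rule expectation_indep_finite[where F = "\<lambda>k h. ?F k (?S h)" and g = "\<lambda>h. h n"])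
      (auto simp: measurable_PiM_count_space_finite S PiE_iff
        simp del: transpose_matrix_vector intro: F(1))
  then have "m (Suc n) = (\<Sum>k = 1..N. prob (\<gamma> n -` {k} \<inter> space M) *\<^sub>R expectation (\<lambda>\<omega>. ?F k (?X \<omega>)))"
    by (simp add: S m_def Let_def)
  also have "\<dots> = (1 / real N) *\<^sub>R (\<Sum>k = 1..N. ?F k (m n))"
    by (simp only: F(2) scaleR_sum_right) (simp add: prob)
  also have "\<dots> = m n - \<eta> *\<^sub>R (mean_gram N A *v m n
    - (1 / real N) *\<^sub>R (\<Sum>k = 1..N. transpose (A k) *v b k) + \<alpha> *\<^sub>R m n)"
    using \<open>N \<ge> 1\<close>
    by (simp add: mean_gram_mult sum_subtractf sum.distrib scaleR_sum_right[symmetric]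
        sum_constant_scaleR algebra_simps del: sum_constant)
  finally show ?thesis .
qed

section \<open>Geometric decay of the mean error\<close>

theorem theorem2:
  fixes N :: nat
    and A :: "nat \<Rightarrow> real ^ 'nx ^ 'np"
    and b :: "nat \<Rightarrow> real ^ 'np"
    and \<alpha> \<eta> C\<^sub>A :: real
    and \<sigma>0 \<sigma>_opt :: "real ^ 'nx"
    and M :: "'w measure"
    and \<gamma> :: "nat \<Rightarrow> 'w \<Rightarrow> nat"
  assumes "N \<ge> 1"
    and "\<alpha> > 0"
    and "is_arg_min (objective N A b \<alpha>) (\<lambda>\<sigma>. True) \<sigma>_opt"
    and "prob_space M"
    and "iid_uniform_indices M N \<gamma>"
    and "spectral_norm (mean_gram N A) \<le> C\<^sub>A"
    and "0 < \<eta>"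
    and "\<eta> < 2 / (C\<^sub>A + \<alpha>)"
  shows "let u = (\<lambda>n. prob_space.expectation M (\<lambda>\<omega>. sgd A b \<alpha> \<eta> \<sigma>0 \<gamma> n \<omega> - \<sigma>_opt));
             rate = spectral_norm (mat 1 - \<eta> *\<^sub>R mean_gram N A - (\<eta> * \<alpha>) *\<^sub>R mat 1)
         in \<bar>rate\<bar> < 1 \<and> (\<forall>n. norm (u n) \<le> rate ^ n * norm (u 0))"
proof -
  interpret prob_space M by fact
  let ?B = "mat 1 - \<eta> *\<^sub>R mean_gram N A - (\<eta> * \<alpha>) *\<^sub>R mat 1 :: real ^ 'nx ^ 'nx"
  let ?u = "\<lambda>n. expectation (\<lambda>\<omega>. sgd A b \<alpha> \<eta> \<sigma>0 \<gamma> n \<omega> - \<sigma>_opt)"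
  have B: "?B *v x = x - \<eta> *\<^sub>R (mean_gram N A *v x) - (\<eta> * \<alpha>) *\<^sub>R x" for x
    by (simp add: matrix_vector_mult_diff_rdistrib scaleR_matrix_vector_assoc[symmetric])
  have indep: "indep_vars (\<lambda>n. count_space {1..N}) \<gamma> UNIV"
    using assms(5) by (simp add: iid_uniform_indices_def)
  \<comment> \<open>Nonnegativity comes from the norm bounded by \<open>C\<^sub>A\<close>; with
    \<open>\<alpha> > 0\<close> it makes the denominator of the step size bound positive.\<close>
  have C: "0 \<le> C\<^sub>A"
    using spectral_norm_nonneg assms(6) by (rule order_trans)
  obtain r where r: "0 \<le> r" "r < 1" "\<And>x. norm (?B *v x) \<le> r * norm x"
    unfolding B
  proof (rule regularized_gradient_step_contraction[of "(*v) (mean_gram N A)" C\<^sub>A \<alpha> \<eta>])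
    show "linear ((*v) (mean_gram N A))"
      by (rule matrix_vector_mul_linear)
    show "(mean_gram N A *v x) \<bullet> y = x \<bullet> (mean_gram N A *v y)" for x y
      by (subst inner_commute) (simp add: inner_mean_gram inner_commute)
    show "0 \<le> x \<bullet> (mean_gram N A *v x)" for x
      by (simp add: inner_mean_gram sum_nonneg)
    show "norm (mean_gram N A *v x) \<le> C\<^sub>A * norm x" for x
      using spectral_norm_mult mult_right_mono[OF assms(6) norm_ge_zero] by (rule order_trans)
  qed (use C assms in auto)
  \<comment> \<open>The induced norm is the least uniform factor, so it inherits the bound
    \<open>r < 1\<close>.\<close>
  have "spectral_norm ?B \<le> r"
    unfolding spectral_norm_def using r(3) by (rule onorm_le)
  then have rate: "\<bar>spectral_norm ?B\<bar> < 1"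
    using r(2) spectral_norm_nonneg[of ?B] by linarith
  have u: "?u n = expectation (sgd A b \<alpha> \<eta> \<sigma>0 \<gamma> n) - \<sigma>_opt" for n
    using integrable_sgd[OF indep, of A b \<alpha> \<eta> \<sigma>0 n] by (simp add: prob_space)
  \<comment> \<open>The normal equation replaces the averaged data by terms in
    \<open>\<sigma>_opt\<close>, so the affine mean recursion becomes linear in the error.\<close>
  have step: "?u (Suc n) = ?B *v ?u n" for n
    unfolding B u expectation_sgd_Suc[OF assms(1,5)] normal_equation[OF assms(1,3)]
    by (simp add: matrix_vector_mult_diff_distrib algebra_simps)
  have "norm (?u n) \<le> spectral_norm ?B ^ n * norm (?u 0)" for n
  proof (induction n)
    case (Suc n)
    have "norm (?u (Suc n)) \<le> spectral_norm ?B * norm (?u n)"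
      unfolding step by (rule spectral_norm_mult)
    also have "\<dots> \<le> spectral_norm ?B * (spectral_norm ?B ^ n * norm (?u 0))"
      by (rule mult_left_mono[OF Suc spectral_norm_nonneg])
    finally show ?case
      by simp
  qed simp
  with rate show ?thesis
    by (simp add: Let_def)
qed

end
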